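(* Let $\mathbb{K}$ be a field, let $G$ be a connected graph with vertex set $[\ell]=\{1,\dots,\ell\}$ and let $h(P_G)=(h_0,h_1,\dots,h_{\ell-1})$ be the $h$-vector of $P_G$. Then $$\mathrm{Hilb}\big(D(\mathcal{A}_G),t\big)=\frac{1}{(1-t)^\ell}\big(h_0+h_1t+\cdots+h_{\ell-1}t^{\ell-1}\big).$$
   Context: Graphs are finite and simple, $\ell\ge1$. $S=\mathbb{K}[x_1,\dots,x_\ell]$ with the standard grading, $\mathrm{Der}(S)=\bigoplus_{i=1}^\ell S\,\partial_{x_i}$, graded by polynomial degree (each $\partial_{x_i}$ has degree $0$, i.e. $\sum f_i\partial_{x_i}$ is homogeneous of degree $d$ if every $f_i$ is homogeneous of degree $d$). The logarithmic vector field of the graphic arrangement $\mathcal{A}_G$ is the graded $S$-module $D(\mathcal{A}_G)=\{\theta\in \mathrm{Der}(S)\mid \theta(x_u-x_v)\in (x_u-x_v)S \text{ for every edge }\{u,v\}\text{ of }G\}$. For a graded $\mathbb{K}$-vector space $M=\bigoplus_i M_i$, $\mathrm{Hilb}(M,t)=\sum_{i\in\mathbb{Z}}(\dim_{\mathbb{K}}M_i)t^i$. $P_G=\{(V(C),T)\mid T\subsetneq[\ell],\ C \text{ a connected component of } G-T\}$, where $G-T$ is obtained from $G$ by deleting the vertices in $T$ and $V(C)$ is the vertex set of $C$. Set $\mathrm{rank}(W,T)=|T|$. The $f$-vector $(f_0,\dots,f_{\ell-1})$ of $P_G$ is given by $f_k=|\{\sigma\in P_G\mid \mathrm{rank}(\sigma)=k\}|$,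 and the $h$-vector $(h_0,\dots,h_{\ell-1})$ of $P_G$ is defined by $$\sum_{k=0}^{\ell-1}f_kt^k(1-t)^{\ell-1-k}=\sum_{k=0}^{\ell-1}h_kt^k.$$ *)

theory Defs
  imports
    "HOL-Library.Poly_Mapping"
    "HOL-Computational_Algebra.Polynomial"
    "HOL-Computational_Algebra.Formal_Power_Series"
    "Graph_Theory.Graph_Theory"
begin

section \<open>The polynomial ring and its derivations\<close>

text \<open>Exponent vectors are finitely supported maps from variable indices to exponents. The product
  on the type is the convolution product, so it is the polynomial ring in countably many variables,
  of which \<open>polys l\<close> is the subring \<open>S = K[x_1, \<dots>, x_l]\<close>.\<close>

type_synonym 'k mpoly = "(nat \<Rightarrow>\<^sub>0 nat) \<Rightarrow>\<^sub>0 'k"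

definition polys :: "nat \<Rightarrow> 'k::field mpoly set" where
  "polys l = {p. \<forall>m \<in> Poly_Mapping.keys p. Poly_Mapping.keys m \<subseteq> {1..l}}"

definition const :: "'k \<Rightarrow> 'k::field mpoly" where
  "const c = Poly_Mapping.single 0 c"

definition var :: "nat \<Rightarrow> 'k::field mpoly" where
  "var i = Poly_Mapping.single (Poly_Mapping.single i 1) 1"

definition mdeg :: "(nat \<Rightarrow>\<^sub>0 nat) \<Rightarrow> nat" where
  "mdeg m = (\<Sum>i \<in> Poly_Mapping.keys m. Poly_Mapping.lookup m i)"

definition homogeneous :: "nat \<Rightarrow> 'k::field mpoly \<Rightarrow> bool" where
  "homogeneous d p \<longleftrightarrow> (\<forall>m \<in> Poly_Mapping.keys p. mdeg m = d)"

text \<open>The subtraction of exponent vectors truncates at 0, but only where the coefficient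
  \<open>lookup m i\<close> vanishes.\<close>

definition partial :: "nat \<Rightarrow> 'k::field mpoly \<Rightarrow> 'k mpoly" where
  "partial i p = (\<Sum>m \<in> Poly_Mapping.keys p.
     Poly_Mapping.single (m - Poly_Mapping.single i 1)
       (of_nat (Poly_Mapping.lookup m i) * Poly_Mapping.lookup p m))"

text \<open>An element \<open>\<theta>\<close> of the direct sum of the \<open>S \<partial>\<^sub>i\<close> is stored as the finitely supported map
  sending \<open>i\<close> to the coefficient of \<open>\<partial>\<^sub>i\<close>; \<open>app \<theta>\<close> is the operator it denotes.\<close>

type_synonym 'k der = "nat \<Rightarrow>\<^sub>0 'k mpoly"

definition Der :: "nat \<Rightarrow> 'k::field der set" where
  "Der l = {\<theta>. Poly_Mapping.keys \<theta> \<subseteq> {1..l} \<and> (\<forall>i. Poly_Mapping.lookup \<theta> i \<in> polys l)}"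

definition app :: "'k::field der \<Rightarrow> 'k mpoly \<Rightarrow> 'k mpoly" where
  "app \<theta> p = (\<Sum>i \<in> Poly_Mapping.keys \<theta>. Poly_Mapping.lookup \<theta> i * partial i p)"

definition der_homogeneous :: "nat \<Rightarrow> 'k::field der \<Rightarrow> bool" where
  "der_homogeneous d \<theta> \<longleftrightarrow> (\<forall>i. homogeneous d (Poly_Mapping.lookup \<theta> i))"

definition der_scale :: "'k \<Rightarrow> 'k::field der \<Rightarrow> 'k der" where
  "der_scale c \<theta> = Poly_Mapping.map (\<lambda>p. const c * p) \<theta>"

lemma lookup_der_scale:
  "Poly_Mapping.lookup (der_scale c \<theta>) i = const c * Poly_Mapping.lookup \<theta> i"
  unfolding der_scale_def by (simp add: Poly_Mapping.map.rep_eq when_def)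

global_interpretation der: vector_space "der_scale :: 'k::field \<Rightarrow> 'k der \<Rightarrow> 'k der"
proof
  fix a b :: 'k and x y :: "'k der"
  show "der_scale a (x + y) = der_scale a x + der_scale a y"
    by (rule poly_mapping_eqI) (simp add: lookup_der_scale lookup_add distrib_left)
  show "der_scale (a + b) x = der_scale a x + der_scale b x"
    by (rule poly_mapping_eqI)
      (simp add: lookup_der_scale lookup_add const_def single_add distrib_right)
  show "der_scale a (der_scale b x) = der_scale (a * b) x"
    by (rule poly_mapping_eqI)
      (simp add: lookup_der_scale const_def mult_single flip: mult.assoc)
  show "der_scale 1 x = x"
    by (rule poly_mapping_eqI) (simp add: lookup_der_scale const_def)
qed

text \<open>Degrees are nonnegative, so the sum over all integers is one over the naturals. The
  coefficients are rationals to have fractions of power series. The function \<open>der.dim\<close> is 0 on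
  infinite-dimensional spaces; this does not arise for \<open>M \<subseteq> Der l\<close>, whose homogeneous components
  are finite-dimensional.\<close>

definition Hilb :: "'k::field der set \<Rightarrow> rat fps" where
  "Hilb M = Abs_fps (\<lambda>d. of_nat (der.dim {\<theta> \<in> M. der_homogeneous d \<theta>}))"

section \<open>Graphs\<close>

text \<open>A finite simple graph is a digraph satisfying the locale \<open>graph\<close>: finite, symmetric,
  without loops or parallel arcs. An edge is a pair of opposite arcs; the two conditions they
  impose below agree up to sign.\<close>

definition log_der :: "nat \<Rightarrow> (nat, 'e) pre_digraph \<Rightarrow> 'k::field der set" where
  "log_der l G = {\<theta> \<in> Der l. \<forall>u v. u \<rightarrow>\<^bsub>G\<^esub> v \<longrightarrow>
     (\<exists>q \<in> polys l. app \<theta> (var u - var v) = (var u - var v) * q)}"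

definition component :: "('a, 'e) pre_digraph \<Rightarrow> ('a, 'e) pre_digraph \<Rightarrow> bool" where
  "component H C \<longleftrightarrow> pre_digraph.max_subgraph H Digraph_Component.connected C"

definition PG :: "('a, 'e) pre_digraph \<Rightarrow> ('a set \<times> 'a set) set" where
  "PG G = {(verts C, T) | C T. T \<subset> verts G \<and> component (G \<restriction> (verts G - T)) C}"

definition rank :: "'a set \<times> 'a set \<Rightarrow> nat" where
  "rank \<sigma> = card (snd \<sigma>)"

definition f_vec :: "('a, 'e) pre_digraph \<Rightarrow> nat \<Rightarrow> nat" where
  "f_vec G k = card {\<sigma> \<in> PG G. rank \<sigma> = k}"

definition f_sum :: "nat \<Rightarrow> ('a, 'e) pre_digraph \<Rightarrow> int poly" where
  "f_sum l G = (\<Sum>k<l. of_nat (f_vec G k) * [:0, 1:] ^ k * (1 - [:0, 1:]) ^ (l - 1 - k))"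

definition h_vec :: "nat \<Rightarrow> ('a, 'e) pre_digraph \<Rightarrow> nat \<Rightarrow> int" where
  "h_vec l G k = coeff (f_sum l G) k"

text \<open>The identity that defines the h-vector: no coefficient of \<open>f_sum\<close> is lost.\<close>

lemma f_sum_eq_h_vec:
  assumes "l \<ge> 1"
  shows "f_sum l G = (\<Sum>k<l. of_int (h_vec l G k) * [:0, 1:] ^ k)"
proof -
  have "degree (f_sum l G) \<le> l - 1"
    unfolding f_sum_def
  proof (rule degree_sum_le)
    fix k assume "k \<in> {..<l}"
    let ?A = "of_nat (f_vec G k) :: int poly" and ?B = "[:0, 1:] ^ k :: int poly"
    let ?C = "(1 - [:0, 1:]) ^ (l - 1 - k) :: int poly"
    have "degree ?A = 0" by (simp add: of_nat_poly)
    moreover have "degree ?B \<le> k"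
      using degree_power_le[of "[:0, 1:] :: int poly" k] by simp
    moreover have "degree ?C \<le> l - 1 - k"
      using degree_power_le[of "1 - [:0, 1:] :: int poly" "l - 1 - k"]
      by (simp add: one_pCons)
    ultimately have "degree (?A * ?B * ?C) \<le> 0 + k + (l - 1 - k)"
      using degree_mult_le[of "?A * ?B" ?C] degree_mult_le[of ?A ?B] by linarith
    with \<open>k \<in> {..<l}\<close> show "degree (?A * ?B * ?C) \<le> l - 1" by simp
  qed simp
  then have "f_sum l G = (\<Sum>k\<le>l - 1. monom (coeff (f_sum l G) k) k)"
    by (rule poly_as_sum_of_monoms'[symmetric])
  also have "{..l - 1} = {..<l}" using assms by auto
  finally show ?thesis
    by (simp add: h_vec_def monom_altdef of_int_poly)
qed

end

theory Submission
  imports Defs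
begin

text \<open>
  Write \<open>\<theta> = \<Sum>\<^sub>v f\<^sub>v \<partial>\<^sub>v\<close>. Since \<open>\<theta> (x\<^sub>u - x\<^sub>v) = f\<^sub>u - f\<^sub>v\<close>, the module \<open>D(A\<^sub>G)\<close> consists
  of the families of polynomials with \<open>f\<^sub>u \<equiv> f\<^sub>v\<close> modulo \<open>x\<^sub>u - x\<^sub>v\<close> along every edge. Expand each
  \<open>f\<^sub>v\<close> in the coordinates centred at \<open>v\<close>, that is in \<open>y = x\<^sub>v\<close> and \<open>z\<^sub>t = x\<^sub>t - x\<^sub>v\<close> for \<open>t \<noteq> v\<close>.
  Modulo \<open>x\<^sub>u - x\<^sub>v\<close> the coordinates centred at \<open>u\<close> and at \<open>v\<close> become equal, while \<open>z\<^sub>v\<close>, respectively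
  \<open>z\<^sub>u\<close>, becomes zero. The edge condition therefore decouples into one condition for each monomial:
  if \<open>m\<close> is a monomial in \<open>y\<close> and the \<open>z\<^sub>t\<close> that involves neither \<open>z\<^sub>u\<close> nor \<open>z\<^sub>v\<close>, then its coefficients
  in \<open>f\<^sub>u\<close> and in \<open>f\<^sub>v\<close> agree (\<open>edge_condition_iff_coef\<close>).

  Let \<open>T\<close> be the set of all \<open>t\<close> such that \<open>z\<^sub>t\<close> occurs in \<open>m\<close>. The coefficient of \<open>m\<close> in \<open>f\<^sub>v\<close> exists
  only for \<open>v \<notin> T\<close>, and the conditions say that it is constant on the components of \<open>G - T\<close>. Hence the
  part of degree \<open>d\<close> has a basis indexed by the pairs of an element \<open>(W, T)\<close> of \<open>P\<^sub>G\<close> and a monomial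
  of degree \<open>d\<close> in \<open>y\<close> and the \<open>z\<^sub>t\<close> in which exactly the \<open>z\<^sub>t\<close> with \<open>t \<in> T\<close> occur. There are \<open>d\<close>
  choose \<open>|T|\<close> such monomials (\<open>card_monoms\<close>), so that the dimension is
  \<open>\<Sum>\<^sub>k f\<^sub>k (d choose k)\<close> (\<open>dim_log_der\<close>). As \<open>\<Sum>\<^sub>d (d choose k) t\<^sup>d = t\<^sup>k / (1 - t)\<^sup>k\<^sup>+\<^sup>1\<close>, the Hilbert
  series is \<open>\<Sum>\<^sub>k f\<^sub>k t\<^sup>k / (1 - t)\<^sup>k\<^sup>+\<^sup>1\<close>, and by the definition of the \<open>h\<close>-vector this is
  \<open>\<Sum>\<^sub>k h\<^sub>k t\<^sup>k / (1 - t)\<^sup>l\<close> (\<open>h_vec_generating_function\<close>).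
\<close>

abbreviation "lookup \<equiv> Poly_Mapping.lookup"
abbreviation "keys \<equiv> Poly_Mapping.keys"
abbreviation "single \<equiv> Poly_Mapping.single"

section \<open>Polynomials as sums and products of variables\<close>

lemma poly_mapping_eq_sum_single: "p = (\<Sum>m\<in>keys p. single m (lookup p m))"
proof (rule poly_mapping_eqI)
  fix k
  have "lookup (\<Sum>m\<in>keys p. single m (lookup p m)) k = (\<Sum>m\<in>keys p. if m = k then lookup p m else 0)"
    by (simp add: lookup_sum lookup_single when_def)
  also have "\<dots> = lookup p k"
    by (simp add: in_keys_iff)
  finally show "lookup p k = lookup (\<Sum>m\<in>keys p. single m (lookup p m)) k" by simp
qed

lemma var_power: "(var i :: 'k::field mpoly) ^ n = single (single i n) 1"
  by (induction n) (simp_all add: var_def mult_single flip: single_add)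

lemma prod_single_one:
  "finite A \<Longrightarrow> (\<Prod>i\<in>A. single (f i) (1 :: 'k::field)) = (single (\<Sum>i\<in>A. f i) 1 :: 'k mpoly)"
  by (induction A rule: finite_induct) (simp_all add: mult_single)

lemma single_eq_const_mult_prod_var:
  "(single m c :: 'k::field mpoly) = const c * (\<Prod>i\<in>keys m. var i ^ lookup m i)"
proof -
  have "(\<Prod>i\<in>keys m. var i ^ lookup m i) = (single m 1 :: 'k mpoly)"
    using poly_mapping_eq_sum_single[of m] by (simp add: var_power prod_single_one)
  then show ?thesis by (simp add: const_def mult_single)
qed

lemma const_zero [simp]: "const 0 = 0" and const_one [simp]: "const 1 = 1"
  by (simp_all add: const_def)

lemma const_add: "const (a + b) = const a + const b"
  by (simp add: const_def single_add)

lemma const_mult: "const (a * b) = const a * const b"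
  by (simp add: const_def mult_single)

definition polys_in :: "nat set \<Rightarrow> 'k::field mpoly set" where
  "polys_in V = {p. \<forall>m\<in>keys p. keys m \<subseteq> V}"

text \<open>Statements that are compatible with sums and products, in particular the equality of two ring
  homomorphisms, need to be checked on constants and variables only.\<close>

lemma polys_in_induct [consumes 1, case_names const var add mult]:
  fixes p :: "'k::field mpoly"
  assumes p: "p \<in> polys_in V"
    and const: "\<And>c. P (const c)"
    and var: "\<And>i. i \<in> V \<Longrightarrow> P (var i)"
    and add: "\<And>p q. P p \<Longrightarrow> P q \<Longrightarrow> P (p + q)"
    and mult: "\<And>p q. P p \<Longrightarrow> P q \<Longrightarrow> P (p * q)"
  shows "P p"
proof -
  have zero: "P 0" and one: "P 1" using const[of 0] const[of 1] by simp_all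
  have sum: "P (\<Sum>x\<in>A. f x)" if "finite A" "\<And>x. x \<in> A \<Longrightarrow> P (f x)" for A :: "(nat \<Rightarrow>\<^sub>0 nat) set" and f
    using that by (induction A rule: finite_induct) (auto intro: zero add)
  have prod: "P (\<Prod>x\<in>A. f x)" if "finite A" "\<And>x. x \<in> A \<Longrightarrow> P (f x)" for A :: "nat set" and f
    using that by (induction A rule: finite_induct) (auto intro: one mult)
  have pow: "P (q ^ n)" if "P q" for q n
    using that by (induction n) (auto intro: one mult)
  show ?thesis
    by (subst poly_mapping_eq_sum_single, subst single_eq_const_mult_prod_var)
      (use p in \<open>unfold polys_in_def, blast intro!: sum prod pow mult const var finite_keys\<close>)
qed

section \<open>Substitution\<close>

text \<open>The homomorphism of \<open>K\<close>-algebras that sends the variable \<open>i\<close> to \<open>\<sigma> i\<close>.\<close>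

definition subst :: "(nat \<Rightarrow> 'k mpoly) \<Rightarrow> 'k::field mpoly \<Rightarrow> 'k mpoly" where
  "subst \<sigma> p = (\<Sum>m\<in>keys p. const (lookup p m) * (\<Prod>i\<in>keys m. \<sigma> i ^ lookup m i))"

lemma subst_single: "subst \<sigma> (single m c) = const c * (\<Prod>i\<in>keys m. \<sigma> i ^ lookup m i)"
  by (simp add: subst_def)

lemma subst_const [simp]: "subst \<sigma> (const c) = const c"
  by (simp add: subst_single const_def[of c])

lemma subst_var [simp]: "subst \<sigma> (var i) = \<sigma> i"
  by (simp add: subst_single var_def)

lemma subst_zero [simp]: "subst \<sigma> 0 = 0"
  by (simp add: subst_def)

lemma subst_add [simp]: "subst \<sigma> (p + q) = subst \<sigma> p + subst \<sigma> q"
  unfolding subst_def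
  by (rule setsum_keys_plus_distrib) (simp_all add: const_add distrib_right)

lemma subst_diff [simp]: "subst \<sigma> (p - q) = subst \<sigma> p - subst \<sigma> q"
  using subst_add[of \<sigma> "p - q" q] by (simp add: algebra_simps del: subst_add)

lemma subst_sum: "subst \<sigma> (\<Sum>x\<in>A. f x) = (\<Sum>x\<in>A. subst \<sigma> (f x))"
  by (induction A rule: infinite_finite_induct) simp_all

lemma prod_keys_add:
  fixes \<sigma> :: "nat \<Rightarrow> 'k::field mpoly"
  shows "(\<Prod>i\<in>keys (m + n). \<sigma> i ^ lookup (m + n) i)
    = (\<Prod>i\<in>keys m. \<sigma> i ^ lookup m i) * (\<Prod>i\<in>keys n. \<sigma> i ^ lookup n i)"
proof -
  let ?A = "keys m \<union> keys n"
  have *: "(\<Prod>i\<in>keys k. \<sigma> i ^ lookup k i) = (\<Prod>i\<in>?A. \<sigma> i ^ lookup k i)" if "keys k \<subseteq> ?A" for k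
    using that by (intro prod.mono_neutral_left) (auto simp: in_keys_iff)
  show ?thesis
    using *[of m] *[of n] *[OF keys_add] by (simp add: lookup_add power_add prod.distrib)
qed

lemma subst_mult [simp]:
  fixes p q :: "'k::field mpoly"
  shows "subst \<sigma> (p * q) = subst \<sigma> p * subst \<sigma> q"
proof -
  let ?s = "\<lambda>p m. single m (lookup p m)"
  have "subst \<sigma> ((\<Sum>m\<in>keys p. ?s p m) * (\<Sum>n\<in>keys q. ?s q n))
      = (\<Sum>m\<in>keys p. subst \<sigma> (?s p m)) * (\<Sum>n\<in>keys q. subst \<sigma> (?s q n))"
    by (simp add: sum_product subst_sum mult_single subst_single prod_keys_add const_mult mult_ac)
  then show ?thesis
    by (simp flip: poly_mapping_eq_sum_single subst_sum)
qed

text \<open>Compositions of coordinate changes are computed on the variables that occur.\<close>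

lemma subst_subst:
  fixes p :: "'k::field mpoly"
  assumes "p \<in> polys_in V" and "\<And>i. i \<in> V \<Longrightarrow> subst \<sigma> (\<tau> i) = \<rho> i"
  shows "subst \<sigma> (subst \<tau> p) = subst \<rho> p"
  using assms by (induction p rule: polys_in_induct) simp_all

lemma subst_id_on:
  fixes p :: "'k::field mpoly"
  assumes "p \<in> polys_in V" and "\<And>i. i \<in> V \<Longrightarrow> \<sigma> i = var i"
  shows "subst \<sigma> p = p"
  using assms by (induction p rule: polys_in_induct) simp_all

lemma polys_eq_polys_in: "polys l = polys_in {1..l}"
  by (simp add: polys_def polys_in_def)

lemma polys_in_UNIV [simp]: "p \<in> polys_in UNIV"
  by (simp add: polys_in_def)

lemma polys_in_const [simp]: "const c \<in> polys_in V"
  by (simp add: polys_in_def const_def)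

lemma polys_in_zero [simp]: "0 \<in> polys_in V" and polys_in_one [simp]: "1 \<in> polys_in V"
  by (simp_all add: polys_in_def)

lemma polys_in_var: "i \<in> V \<Longrightarrow> var i \<in> polys_in V"
  by (simp add: polys_in_def var_def)

lemma polys_in_add: "p \<in> polys_in V \<Longrightarrow> q \<in> polys_in V \<Longrightarrow> p + q \<in> polys_in V"
  using keys_add[of p q] by (auto simp: polys_in_def)

lemma polys_in_mult:
  assumes "p \<in> polys_in V" "q \<in> polys_in V"
  shows "p * q \<in> polys_in V"
  unfolding polys_in_def
proof safe
  fix m i assume "m \<in> keys (p * q)" "i \<in> keys m"
  then obtain a b where "m = a + b" "a \<in> keys p" "b \<in> keys q"
    using keys_mult[of p q] by blast
  with assms keys_add[of a b] \<open>i \<in> keys m\<close> show "i \<in> V"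
    by (fastforce simp: polys_in_def)
qed

lemma polys_in_diff: "p \<in> polys_in V \<Longrightarrow> q \<in> polys_in V \<Longrightarrow> p - q \<in> polys_in V"
proof -
  have "keys (p - q) \<subseteq> keys p \<union> keys q" by (auto simp: in_keys_iff lookup_minus)
  then show "p \<in> polys_in V \<Longrightarrow> q \<in> polys_in V \<Longrightarrow> p - q \<in> polys_in V"
    by (auto simp: polys_in_def)
qed

lemma subst_in_polys_in:
  assumes "p \<in> polys_in U" and "\<And>i. i \<in> U \<Longrightarrow> \<sigma> i \<in> polys_in V"
  shows "subst \<sigma> p \<in> polys_in V"
  using assms by (induction p rule: polys_in_induct) (simp_all add: polys_in_add polys_in_mult)

lemma mdeg_add: "mdeg (m + n) = mdeg m + mdeg n"
  unfolding mdeg_def by (rule setsum_keys_plus_distrib) simp_all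

lemma mdeg_zero [simp]: "mdeg 0 = 0"
  by (simp add: mdeg_def)

lemma mdeg_single [simp]: "mdeg (single i n) = n"
  by (simp add: mdeg_def)

lemma mdeg_eq_0_iff: "mdeg m = 0 \<longleftrightarrow> m = 0"
  by (metis mdeg_def finite_keys in_keys_iff mdeg_zero poly_mapping_eqI lookup_zero sum_eq_0_iff)

lemma homogeneous_var [simp]: "homogeneous 1 (var i)"
  by (simp add: homogeneous_def var_def)

lemma homogeneous_const [simp]: "homogeneous 0 (const c)"
  by (simp add: homogeneous_def const_def)

lemma homogeneous_add: "homogeneous d p \<Longrightarrow> homogeneous d q \<Longrightarrow> homogeneous d (p + q)"
  using keys_add[of p q] by (auto simp: homogeneous_def)

lemma homogeneous_diff: "homogeneous d p \<Longrightarrow> homogeneous d q \<Longrightarrow> homogeneous d (p - q)"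
  by (auto simp: homogeneous_def in_keys_iff lookup_minus)

lemma homogeneous_mult: "homogeneous d p \<Longrightarrow> homogeneous e q \<Longrightarrow> homogeneous (d + e) (p * q)"
  unfolding homogeneous_def using keys_mult[of p q] mdeg_add by fastforce

lemma homogeneous_zero [simp]: "homogeneous d 0"
  by (simp add: homogeneous_def)

lemma homogeneous_subst:
  fixes p :: "'k::field mpoly"
  assumes "homogeneous d p" and "\<And>i. homogeneous 1 (\<sigma> i)"
  shows "homogeneous d (subst \<sigma> p)"
proof -
  have pow: "homogeneous n (\<sigma> i ^ n)" for i n
    using homogeneous_mult[OF assms(2)] homogeneous_const[of "1 :: 'k"] by (induction n) simp_all
  have prod: "homogeneous (\<Sum>i\<in>A. f i) (\<Prod>i\<in>A. \<sigma> i ^ f i)" if "finite A" for A f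
    using that homogeneous_const[of "1 :: 'k"]
    by (induction A rule: finite_induct) (simp_all add: homogeneous_mult pow)
  have sum: "homogeneous d (\<Sum>x\<in>A. g x)" if "finite A" "\<And>x. x \<in> A \<Longrightarrow> homogeneous d (g x)"
    for A :: "(nat \<Rightarrow>\<^sub>0 nat) set" and g
    using that by (induction A rule: finite_induct) (simp_all add: homogeneous_add)
  show ?thesis
    unfolding subst_def
  proof (rule sum)
    fix m assume "m \<in> keys p"
    then have "mdeg m = d" using assms(1) by (simp add: homogeneous_def)
    then show "homogeneous d (const (lookup p m) * (\<Prod>i\<in>keys m. \<sigma> i ^ lookup m i))"
      using homogeneous_mult[OF homogeneous_const prod[of "keys m" "lookup m"]]
      by (simp add: mdeg_def)
  qed simp
qed

section \<open>Local coordinates\<close>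

text \<open>Coordinates centred at the vertex \<open>v\<close>: the index 0, which is not a vertex, names the variable
  \<open>y = x\<^sub>v\<close>, and an index \<open>i\<close> different from 0 and \<open>v\<close> names \<open>x\<^sub>i - x\<^sub>v\<close>. Substituting
  \<open>to_local v\<close> rewrites an element of \<open>S\<close> in these coordinates; the result does not involve the index
  \<open>v\<close>. Using the same name \<open>y\<close> for every \<open>v\<close> makes the coefficients at different vertices comparable.\<close>

definition to_local :: "nat \<Rightarrow> nat \<Rightarrow> 'k::field mpoly" where
  "to_local v i = (if i = v then var 0 else var i + var 0)"

definition from_local :: "nat \<Rightarrow> nat \<Rightarrow> 'k::field mpoly" where
  "from_local v i = (if i = 0 then var v else var i - var v)"

text \<open>Reduction modulo \<open>x\<^sub>u - x\<^sub>v\<close>, written in the common coordinates centred at \<open>u\<close> and \<open>v\<close>.\<close>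

definition to_edge_local :: "nat \<Rightarrow> nat \<Rightarrow> nat \<Rightarrow> 'k::field mpoly" where
  "to_edge_local u v i = (if i = u \<or> i = v then var 0 else var i + var 0)"

definition kill :: "nat \<Rightarrow> nat \<Rightarrow> 'k::field mpoly" where
  "kill v i = (if i = v then 0 else var i)"

lemma subst_kill_single: "subst (kill v) (single m c) = (if lookup m v = 0 then single m c else 0)"
proof (cases "lookup m v = 0")
  case True
  then have "(\<Prod>i\<in>keys m. kill v i ^ lookup m i) = (\<Prod>i\<in>keys m. (var i :: 'a mpoly) ^ lookup m i)"
    by (intro prod.cong) (auto simp: kill_def in_keys_iff)
  with True show ?thesis
    unfolding subst_single by (simp add: single_eq_const_mult_prod_var[of m c])
next
  case False
  then have "(\<Prod>i\<in>keys m. kill v i ^ lookup m i) = (0 :: 'a mpoly)"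
    by (intro prod_zero bexI[of _ v]) (auto simp: kill_def in_keys_iff)
  with False show ?thesis by (simp add: subst_single)
qed

lemma lookup_subst_kill: "lookup (subst (kill v) p) m = (if lookup m v = 0 then lookup p m else 0)"
proof -
  have "lookup (subst (kill v) (single n c)) m
      = (if n = m then if lookup m v = 0 then c else 0 else 0)" for n and c :: 'a
    by (simp add: subst_kill_single lookup_single)
  then have "lookup (subst (kill v) (\<Sum>n\<in>keys p. single n (lookup p n))) m
      = (\<Sum>n\<in>keys p. if n = m then if lookup m v = 0 then lookup p n else 0 else 0)"
    by (simp add: subst_sum lookup_sum)
  then show ?thesis
    by (simp add: in_keys_iff flip: poly_mapping_eq_sum_single)
qed

lemma subst_from_to_local: "p \<in> polys l \<Longrightarrow> subst (from_local v) (subst (to_local v) p) = p"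
  unfolding polys_eq_polys_in
  by (rule trans[OF subst_subst subst_id_on]) (auto simp: to_local_def from_local_def)

lemma subst_to_from_local: "v \<noteq> 0 \<Longrightarrow> subst (to_local v) (subst (from_local v) p) = subst (kill v) p"
  by (rule subst_subst[of _ UNIV]) (auto simp: to_local_def from_local_def kill_def)

text \<open>Reducing modulo \<open>x\<^sub>u - x\<^sub>v\<close> means discarding, in the coordinates centred at \<open>u\<close>, all monomials
  that involve \<open>x\<^sub>v - x\<^sub>u\<close>.\<close>

lemma subst_to_edge_local:
  assumes "p \<in> polys l" "v \<noteq> 0" "u \<noteq> v"
  shows "subst (to_edge_local u v) p = subst (kill v) (subst (to_local u) p)"
  using assms unfolding polys_eq_polys_in
  by (intro subst_subst[symmetric]) (auto simp: to_local_def to_edge_local_def kill_def)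

text \<open>The kernel of \<open>to_edge_local u v\<close> on \<open>S\<close> is the ideal generated by \<open>x\<^sub>u - x\<^sub>v\<close>: the
  substitution \<open>\<pi>\<close> of \<open>x\<^sub>v\<close> for \<open>x\<^sub>u\<close> factors through that map, and \<open>p - \<pi> p\<close> is always a multiple of \<open>x\<^sub>u - x\<^sub>v\<close>.\<close>

lemma dvd_var_diff_iff:
  fixes p :: "'k::field mpoly"
  assumes p: "p \<in> polys l" and uv: "u \<in> {1..l}" "v \<in> {1..l}"
  shows "(\<exists>q\<in>polys l. p = (var u - var v) * q) \<longleftrightarrow> subst (to_edge_local u v) p = 0"
proof
  assume "subst (to_edge_local u v) p = 0"
  define \<pi> :: "nat \<Rightarrow> 'k mpoly" where "\<pi> i = (if i = u then var v else var i)" for i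
  have "p \<in> polys_in {1..l} \<and> (\<exists>q\<in>polys_in {1..l}. p - subst \<pi> p = (var u - var v) * q)"
    using p unfolding polys_eq_polys_in
  proof (induction p rule: polys_in_induct)
    case (const c)
    show ?case by (auto intro!: bexI[of _ 0])
  next
    case (var i)
    then show ?case
      by (cases "i = u") (auto simp: \<pi>_def polys_in_var intro: bexI[of _ 0] bexI[of _ 1])
  next
    case (add p q)
    then obtain a b where "a \<in> polys_in {1..l}" "b \<in> polys_in {1..l}"
      "p - subst \<pi> p = (var u - var v) * a" "q - subst \<pi> q = (var u - var v) * b" by blast
    moreover have "p + q - subst \<pi> (p + q) = (p - subst \<pi> p) + (q - subst \<pi> q)" by simp
    ultimately show ?case
      using add by (auto simp: distrib_left intro!: polys_in_add bexI[of _ "a + b"])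
  next
    case (mult p q)
    then obtain a b where ab: "a \<in> polys_in {1..l}" "b \<in> polys_in {1..l}"
      "p - subst \<pi> p = (var u - var v) * a" "q - subst \<pi> q = (var u - var v) * b" by blast
    have "p * q - subst \<pi> (p * q) = (p - subst \<pi> p) * q + subst \<pi> p * (q - subst \<pi> q)"
      by (simp add: algebra_simps)
    also have "\<dots> = (var u - var v) * (a * q + subst \<pi> p * b)"
      by (simp add: ab algebra_simps)
    finally have eq: "p * q - subst \<pi> (p * q) = (var u - var v) * (a * q + subst \<pi> p * b)" .
    have "subst \<pi> p \<in> polys_in {1..l}"
      using mult uv by (intro subst_in_polys_in[of _ "{1..l}"]) (auto intro: polys_in_var simp: \<pi>_def)
    then have "a * q + subst \<pi> p * b \<in> polys_in {1..l}"
      using mult ab by (intro polys_in_add polys_in_mult) auto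
    with eq show ?case
      using mult by (intro conjI polys_in_mult) blast+
  qed
  moreover have "subst \<pi> p = subst (from_local v) (subst (to_edge_local u v) p)"
    using p unfolding polys_eq_polys_in
    by (intro subst_subst[symmetric]) (auto simp: \<pi>_def from_local_def to_edge_local_def)
  ultimately show "\<exists>q\<in>polys l. p = (var u - var v) * q"
    using \<open>subst (to_edge_local u v) p = 0\<close> by (simp add: polys_eq_polys_in)
qed (auto simp: to_edge_local_def)

lemma homogeneous_to_local: "homogeneous 1 (to_local v i :: 'k::field mpoly)"
  by (simp add: to_local_def homogeneous_add del: One_nat_def)

lemma homogeneous_from_local: "homogeneous 1 (from_local v i :: 'k::field mpoly)"
  by (simp add: from_local_def homogeneous_diff del: One_nat_def)

lemma homogeneous_subst_to_local: "homogeneous d p \<Longrightarrow> homogeneous d (subst (to_local v) p)"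
  by (rule homogeneous_subst[OF _ homogeneous_to_local])

lemma homogeneous_subst_from_local: "homogeneous d p \<Longrightarrow> homogeneous d (subst (from_local v) p)"
  by (rule homogeneous_subst[OF _ homogeneous_from_local])

section \<open>Derivations\<close>

lemma partial_var_diff:
  fixes i u v :: nat
  assumes "u \<noteq> v"
  shows "partial i (var u - var v :: 'k::field mpoly) = (if i = u then 1 else if i = v then -1 else 0)"
proof -
  let ?p = "var u - var v :: 'k mpoly"
  have ne: "single u (1::nat) \<noteq> single v 1" using assms by (metis inj_single lookup_single_eq lookup_single_not_eq one_neq_zero)
  have keys: "keys ?p \<subseteq> {single u 1, single v 1}"
    by (auto simp: in_keys_iff lookup_minus var_def lookup_single when_def split: if_splits)
  have "partial i ?p = (\<Sum>m\<in>{single u 1, single v 1}.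
      single (m - single i 1) (of_nat (lookup m i) * lookup ?p m))"
    unfolding partial_def using keys by (intro sum.mono_neutral_left) (auto simp: in_keys_iff)
  also have "\<dots> = (if i = u then 1 else if i = v then -1 else 0)"
    using ne assms by (auto simp: lookup_minus var_def lookup_single single_uminus)
  finally show ?thesis .
qed

lemma app_var_diff:
  assumes "u \<noteq> v"
  shows "app \<theta> (var u - var v) = lookup \<theta> u - lookup \<theta> v"
proof -
  have "app \<theta> (var u - var v) = (\<Sum>i\<in>keys \<theta> \<union> {u, v}. lookup \<theta> i * partial i (var u - var v))"
    unfolding app_def by (intro sum.mono_neutral_left) (auto simp: in_keys_iff)
  also have "\<dots> = (\<Sum>i\<in>{u, v}. lookup \<theta> i * partial i (var u - var v))"
    by (intro sum.mono_neutral_right) (auto simp: partial_var_diff[OF assms])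
  finally show ?thesis using assms by (simp add: partial_var_diff)
qed

section \<open>Components of vertex-deleted subgraphs\<close>

text \<open>A component is a maximal subgraph whose symmetrization is strongly connected. It competes with
  subgraphs that need not be symmetric. Passing to the induced subgraph on the same vertices, which is
  symmetric, keeps it connected and makes it strongly connected, so both notions have the same maximal
  elements.\<close>

lemma component_iff_scc:
  assumes "sym_digraph H"
  shows "component H C \<longleftrightarrow> C \<in> pre_digraph.sccs H"
proof -
  interpret H: sym_digraph H by fact
  have strong: "strongly_connected D" if "induced_subgraph D H" "Digraph_Component.connected D" for D
  proof -
    interpret D: sym_digraph D using H.induced_graph_imp_graph[OF that(1)] .
    show ?thesis using D.symmetric_connected_imp_strongly_connected that(2) by blast
  qed
  have conn: "Digraph_Component.connected D" if "strongly_connected D" for D :: "('a, 'b) pre_digraph"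
    using that rtrancl_on_mono[of "arcs_ends D" "(arcs_ends D)\<^sup>s" "verts D" "verts D"]
    unfolding connected_conv strongly_connected_def reachable_def symcl_def by blast
  have arc_mono: "arc_mono (Digraph_Component.connected :: ('a, 'b) pre_digraph \<Rightarrow> bool)"
    unfolding arc_mono_def
    by (metis spanning_def subgraphE wf_digraph.connected_spanning_imp_connected)
  show ?thesis
  proof
    assume comp: "component H C"
    then have "induced_subgraph C H"
      unfolding component_def using H.induced_subgraphI_arc_mono arc_mono by blast
    moreover have "Digraph_Component.connected C"
      using comp unfolding component_def by (rule H.max_subgraph_prop)
    ultimately have "strongly_connected C" by (rule strong)
    then have "H.max_subgraph strongly_connected C"
      using comp conn unfolding component_def by (blast intro: H.max_subgraph_mp)
    then show "C \<in> H.sccs" by (simp add: H.sccs_altdef2)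
  next
    assume C: "C \<in> H.sccs"
    show "component H C"
      unfolding component_def
    proof (rule H.max_subgraphI)
      show "Digraph_Component.connected C" using C conn by blast
      show "subgraph C H" using C by (auto dest: H.in_sccs_imp_induced)
      fix D assume D: "C \<noteq> D" "subgraph C D" "subgraph D H"
      show "\<not> Digraph_Component.connected D"
      proof
        assume "Digraph_Component.connected D"
        \<comment> \<open>\<open>D\<close> may lack opposite arcs, so it is replaced by the subgraph induced on its vertices.\<close>
        let ?D = "H \<restriction> verts D"
        have sub: "verts D \<subseteq> verts H" using D(3) by blast
        have ind: "induced_subgraph ?D H" using sub by blast
        have "spanning D ?D"
          using subgraph_induce_subgraphI2[OF D(3)] by (simp add: spanning_def)
        then have "Digraph_Component.connected ?D"
          using wf_digraph.connected_spanning_imp_connected[of ?D D] \<open>Digraph_Component.connected D\<close>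
            H.wellformed_induce_subgraph by blast
        then have "strongly_connected ?D" using strong ind by blast
        moreover have sub_ind: "subgraph D ?D" using D(3) by (rule subgraph_induce_subgraphI2)
        then have "subgraph C ?D" using D(2) subgraph_trans by blast
        moreover have "subgraph ?D H" using ind by (rule induced_imp_subgraph)
        moreover have "H.max_subgraph strongly_connected C" using C by (simp add: H.sccs_altdef2)
        ultimately have "?D = C" unfolding H.max_subgraph_def by metis
        then have "verts C = verts D" "arcs D \<subseteq> arcs C"
          using sub_ind by (auto simp: subgraph_def)
        then have "C = D"
          using D(2) unfolding subgraph_def compatible_def by (intro pre_digraph.equality) auto
        with D(1) show False by blast
      qed
    qed
  qed
qed

lemma verts_components:
  assumes "sym_digraph H"
  shows "verts ` {C. component H C} = (\<lambda>v. {w. v \<rightarrow>\<^sup>*\<^bsub>H\<^esub> w}) ` verts H"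
proof -
  interpret H: sym_digraph H by fact
  have "H.scc_of v = {w. v \<rightarrow>\<^sup>*\<^bsub>H\<^esub> w}" for v
    unfolding H.scc_of_def using symmetric_reachable[OF H.sym_arcs] by auto
  then show ?thesis
    unfolding component_iff_scc[OF assms] using H.sccs_verts_conv H.sccs_verts_conv_scc_of by simp
qed

lemma PG_eq:
  assumes "sym_digraph G"
  shows "PG G = {({w. v \<rightarrow>\<^sup>*\<^bsub>G \<restriction> (verts G - T)\<^esub> w}, T) | v T. T \<subseteq> verts G \<and> v \<in> verts G - T}"
proof -
  interpret G: sym_digraph G by fact
  have *: "sym_digraph (G \<restriction> (verts G - T))" for T
    by (rule G.induced_graph_imp_graph) blast
  have "PG G = (\<Union>T\<in>{T. T \<subset> verts G}. (\<lambda>W. (W, T)) ` verts ` {C. component (G \<restriction> (verts G - T)) C})"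
    unfolding PG_def by auto
  also have "\<dots> = {({w. v \<rightarrow>\<^sup>*\<^bsub>G \<restriction> (verts G - T)\<^esub> w}, T) | v T. T \<subseteq> verts G \<and> v \<in> verts G - T}"
    unfolding verts_components[OF *] by auto
  finally show ?thesis .
qed

text \<open>For fixed \<open>T\<close>, the first entries of the elements \<open>(W, T)\<close> of \<open>P\<^sub>G\<close> partition the vertices
  outside \<open>T\<close>. No arc that avoids \<open>T\<close> joins different blocks, and a function that is constant
  along those arcs is constant on each block.\<close>

context
  fixes G :: "('a, 'b) pre_digraph"
  assumes sym: "sym_digraph G"
begin

lemma PG_subset:
  assumes "(W, T) \<in> PG G"
  shows "W \<subseteq> verts G" "T \<subseteq> verts G" "W \<inter> T = {}" "W \<noteq> {}"
proof -
  interpret G: sym_digraph G by (rule sym)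
  from assms obtain v where v: "T \<subseteq> verts G" "v \<in> verts G - T"
    and W: "W = {w. v \<rightarrow>\<^sup>*\<^bsub>G \<restriction> (verts G - T)\<^esub> w}"
    unfolding PG_eq[OF sym] by blast
  interpret H: wf_digraph "G \<restriction> (verts G - T)" by (rule G.wellformed_induce_subgraph)
  have "W \<subseteq> verts G - T" using H.reachable_in_verts(2) unfolding W by fastforce
  moreover have "v \<in> W" using v(2) unfolding W by simp
  ultimately show "W \<subseteq> verts G" "T \<subseteq> verts G" "W \<inter> T = {}" "W \<noteq> {}" using v(1) by auto
qed

lemma PG_cover:
  assumes "T \<subseteq> verts G" "v \<in> verts G - T"
  shows "\<exists>W. (W, T) \<in> PG G \<and> v \<in> W"
proof -
  let ?H = "G \<restriction> (verts G - T)"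
  interpret H: wf_digraph ?H
    using sym by (simp add: sym_digraph_def wf_digraph.wellformed_induce_subgraph)
  have "v \<rightarrow>\<^sup>*\<^bsub>?H\<^esub> v" using assms(2) by (intro H.reachable_refl) simp
  then show ?thesis
    unfolding PG_eq[OF sym] using assms
    by (intro exI[of _ "{w. v \<rightarrow>\<^sup>*\<^bsub>?H\<^esub> w}"]) blast
qed

lemma PG_disjoint:
  assumes "(W, T) \<in> PG G" "(W', T) \<in> PG G" "v \<in> W" "v \<in> W'"
  shows "W = W'"
proof -
  interpret G: sym_digraph G by (rule sym)
  let ?H = "G \<restriction> (verts G - T)"
  interpret H: sym_digraph ?H by (rule G.induced_graph_imp_graph) blast
  have "X = {w. v \<rightarrow>\<^sup>*\<^bsub>?H\<^esub> w}" if "(X, T) \<in> PG G" "v \<in> X" for X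
    using that unfolding PG_eq[OF sym]
    by (auto intro: H.reachable_trans symmetric_reachable[OF H.sym_arcs])
  then show ?thesis using assms by blast
qed

lemma PG_closed:
  assumes "(W, T) \<in> PG G" "u \<in> W" "u \<rightarrow>\<^bsub>G\<^esub> v" "v \<notin> T"
  shows "v \<in> W"
proof -
  interpret G: sym_digraph G by (rule sym)
  let ?H = "G \<restriction> (verts G - T)"
  interpret H: wf_digraph ?H by (rule G.wellformed_induce_subgraph)
  have "u \<notin> T" using PG_subset(3)[OF assms(1)] assms(2) by blast
  then have "u \<rightarrow>\<^bsub>?H\<^esub> v"
    using assms(3,4) G.adj_in_verts[OF assms(3)] by (auto simp: arcs_ends_conv)
  then show ?thesis
    using assms(1,2) unfolding PG_eq[OF sym] by (auto intro: H.reachable_adj_trans)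
qed

lemma PG_connected:
  assumes "(W, T) \<in> PG G" "u \<in> W" "v \<in> W"
    and arc: "\<And>x y. x \<rightarrow>\<^bsub>G\<^esub> y \<Longrightarrow> x \<notin> T \<Longrightarrow> y \<notin> T \<Longrightarrow> c x = c y"
  shows "c u = c v"
proof -
  interpret G: sym_digraph G by (rule sym)
  let ?H = "G \<restriction> (verts G - T)"
  interpret H: wf_digraph ?H by (rule G.wellformed_induce_subgraph)
  have "c x = c y" if "x \<rightarrow>\<^sup>*\<^bsub>?H\<^esub> y" for x y
    using that
  proof (induction rule: H.reachable_induct)
    case base
    show ?case ..
  next
    case (step y z)
    have "y \<in> verts ?H" "z \<in> verts ?H" using H.adj_in_verts step.hyps(2) by blast+
    then have "c y = c z"
      using arc[OF dominates_induce_subgraphD[OF step.hyps(2)]] by simp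
    then show ?case using step.IH by simp
  qed
  then show ?thesis using assms(1-3) unfolding PG_eq[OF sym] by (auto; metis)
qed

end

section \<open>Counting monomials\<close>

text \<open>Monomials of degree \<open>d\<close> in \<open>y\<close> and the variables indexed by \<open>T\<close>, each of the latter occurring;
  the exponent of \<open>y\<close>, the variable with index 0, is arbitrary.\<close>

definition monoms :: "nat set \<Rightarrow> nat \<Rightarrow> (nat \<Rightarrow>\<^sub>0 nat) set" where
  "monoms T d = {m. keys m - {0} = T \<and> mdeg m = d}"

lemma monoms_empty: "monoms {} d = {single 0 d}"
proof -
  have "m = single 0 d" if m: "keys m - {0} = {}" "mdeg m = d" for m
  proof -
    have "keys m \<subseteq> {0}" using m(1) by blast
    then have "m = single 0 (lookup m 0)"
      by (intro poly_mapping_eqI) (auto simp: lookup_single when_def in_keys_iff subset_iff)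
    with m(2) show ?thesis by (metis mdeg_single)
  qed
  then show ?thesis by (auto simp: monoms_def split: if_splits)
qed

lemma keys_add_single: "keys (m + single t (Suc n)) = insert t (keys m)"
  by (auto simp: in_keys_iff lookup_add lookup_single when_def split: if_splits)

text \<open>Dividing by the variable \<open>t\<close> either removes it or leaves it in the monomial. This is Pascal's
  rule for the cardinalities.\<close>

lemma monoms_insert_Suc:
  assumes "t \<notin> T" "t \<noteq> 0"
  shows "monoms (insert t T) (Suc d) = (\<lambda>m. m + single t 1) ` (monoms T d \<union> monoms (insert t T) d)"
proof (intro Set.equalityI subsetI)
  fix m assume m: "m \<in> monoms (insert t T) (Suc d)"
  then have "t \<in> keys m" unfolding monoms_def by blast
  then have pos: "lookup m t > 0" by (simp add: in_keys_iff)
  have "lookup m k = lookup (m - single t 1 + single t 1) k" for k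
    using pos by (cases "k = t") (simp_all add: lookup_add lookup_minus lookup_single_not_eq)
  then have "m = m - single t 1 + single t 1" by (rule poly_mapping_eqI)
  then obtain n where n: "m = n + single t 1" by blast
  have deg: "mdeg n = d" and keys: "insert t (keys n) - {0} = insert t T"
    using m unfolding n by (simp_all add: monoms_def mdeg_add keys_add_single)
  have "keys n - {0} = T \<or> keys n - {0} = insert t T"
  proof (cases "t \<in> keys n")
    case True
    then have "insert t (keys n) = keys n" by (rule insert_absorb)
    with keys show ?thesis by (simp only:) simp
  next
    case False
    have "insert t (keys n - {0}) = insert t (keys n) - {0}" using assms(2) by blast
    with keys have "insert t (keys n - {0}) = insert t T" by (rule trans[rotated])
    then have "keys n - {0} = T"
      using False assms(1) insert_ident[of t "keys n - {0}" T] by simp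
    then show ?thesis ..
  qed
  then have "n \<in> monoms T d \<union> monoms (insert t T) d"
    using deg by (auto simp: monoms_def)
  then show "m \<in> (\<lambda>m. m + single t 1) ` (monoms T d \<union> monoms (insert t T) d)"
    unfolding n by (rule imageI)
next
  fix m assume "m \<in> (\<lambda>m. m + single t 1) ` (monoms T d \<union> monoms (insert t T) d)"
  then obtain n where n: "m = n + single t 1" "mdeg n = d"
    and keys: "keys n - {0} = T \<or> keys n - {0} = insert t T"
    unfolding monoms_def by blast
  have "insert t (keys n) - {0} = insert t (keys n - {0})" using assms(2) by blast
  also have "\<dots> = insert t T" using keys by (rule disjE) simp_all
  finally show "m \<in> monoms (insert t T) (Suc d)"
    using n by (simp add: monoms_def mdeg_add keys_add_single)
qed

lemma card_monoms:
  assumes "finite T" "0 \<notin> T"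
  shows "finite (monoms T d) \<and> card (monoms T d) = d choose card T"
  using assms
proof (induction T arbitrary: d rule: finite_induct)
  case empty
  show ?case by (simp add: monoms_empty)
next
  case (insert t T)
  show ?case
  proof (induction d)
    case 0
    have "monoms (insert t T) 0 = {}" by (auto simp: monoms_def mdeg_eq_0_iff)
    then show ?case using insert.hyps by simp
  next
    case (Suc d)
    have "monoms T d \<inter> monoms (insert t T) d = {}"
      using insert.hyps by (auto simp: monoms_def)
    moreover have "inj_on (\<lambda>m. m + single t 1) A" for A :: "(nat \<Rightarrow>\<^sub>0 nat) set"
      by (rule inj_onI) simp
    ultimately show ?case
      using insert Suc by (simp add: monoms_insert_Suc card_image card_Un_disjoint)
  qed
qed

section \<open>The generating function of the h-vector\<close>

text \<open>The identity \<open>\<Sum>\<^sub>d (d choose k) t\<^sup>d = t\<^sup>k / (1 - t)\<^sup>k\<^sup>+\<^sup>1\<close>. Multiplication by \<open>1 - t\<close> takes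
  differences of consecutive coefficients, which by Pascal's rule lowers \<open>k\<close> by one.\<close>

lemma fps_binomial_column:
  "Abs_fps (\<lambda>d. of_nat (d choose k)) * (1 - fps_X) ^ Suc k = (fps_X ^ k :: rat fps)"
proof (induction k)
  case 0
  show ?case by (rule fps_ext) (simp add: algebra_simps)
next
  case (Suc k)
  have step: "Abs_fps (\<lambda>d. of_nat (d choose Suc k)) * (1 - fps_X)
      = fps_X * (Abs_fps (\<lambda>d. of_nat (d choose k)) :: rat fps)"
  proof (rule fps_ext)
    fix n
    show "fps_nth (Abs_fps (\<lambda>d. of_nat (d choose Suc k)) * (1 - fps_X)) n
        = fps_nth (fps_X * (Abs_fps (\<lambda>d. of_nat (d choose k)) :: rat fps)) n"
      by (cases n) (simp_all add: right_diff_distrib)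
  qed
  have "Abs_fps (\<lambda>d. of_nat (d choose Suc k)) * (1 - fps_X) ^ Suc (Suc k)
      = (Abs_fps (\<lambda>d. of_nat (d choose Suc k)) * (1 - fps_X)) * (1 - fps_X :: rat fps) ^ Suc k"
    by (simp only: power_Suc[of _ "Suc k"] mult.assoc)
  also have "\<dots> = fps_X * fps_X ^ k"
    unfolding step mult.assoc Suc ..
  finally show ?case by simp
qed

definition fps_of_int_poly :: "int poly \<Rightarrow> rat fps" where
  "fps_of_int_poly p = Abs_fps (\<lambda>i. of_int (coeff p i))"

lemma fps_of_int_poly_add: "fps_of_int_poly (p + q) = fps_of_int_poly p + fps_of_int_poly q"
  by (rule fps_ext) (simp add: fps_of_int_poly_def)

lemma fps_of_int_poly_mult: "fps_of_int_poly (p * q) = fps_of_int_poly p * fps_of_int_poly q"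
  by (rule fps_ext) (simp add: fps_of_int_poly_def coeff_mult fps_mult_nth atMost_atLeast0)

lemma fps_of_int_poly_0: "fps_of_int_poly 0 = 0"
  by (rule fps_ext) (simp add: fps_of_int_poly_def)

lemma fps_of_int_poly_const: "fps_of_int_poly [:c:] = fps_const (of_int c)"
  by (rule fps_ext) (simp add: fps_of_int_poly_def coeff_pCons split: nat.split)

lemma fps_of_int_poly_smult: "fps_of_int_poly (smult c p) = fps_const (of_int c) * fps_of_int_poly p"
  by (rule fps_ext) (simp add: fps_of_int_poly_def)

lemma fps_of_int_poly_X: "fps_of_int_poly [:0, 1:] = fps_X"
  by (rule fps_ext) (simp add: fps_of_int_poly_def coeff_pCons split: nat.split)

lemma fps_of_int_poly_1_minus_X: "fps_of_int_poly (1 - [:0, 1:]) = 1 - fps_X"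
  by (rule fps_ext) (simp add: fps_of_int_poly_def coeff_pCons one_pCons split: nat.split)

lemma fps_of_int_poly_power: "fps_of_int_poly (p ^ n) = fps_of_int_poly p ^ n"
  using fps_of_int_poly_const[of 1]
  by (induction n) (simp_all add: fps_of_int_poly_mult one_pCons)

lemma fps_of_int_poly_sum: "fps_of_int_poly (\<Sum>x\<in>A. f x) = (\<Sum>x\<in>A. fps_of_int_poly (f x))"
  by (induction A rule: infinite_finite_induct) (simp_all add: fps_of_int_poly_0 fps_of_int_poly_add)

lemmas fps_of_int_poly_simps = fps_of_int_poly_mult fps_of_int_poly_smult fps_of_int_poly_X
  fps_of_int_poly_1_minus_X fps_of_int_poly_power fps_of_int_poly_sum

text \<open>The defining identity of the \<open>h\<close>-vector is carried over to power series and divided by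
  \<open>(1 - t)\<^sup>l\<close>; the summand of \<open>f\<^sub>k\<close> becomes \<open>t\<^sup>k / (1 - t)\<^sup>k\<^sup>+\<^sup>1\<close>.\<close>

lemma h_vec_generating_function:
  assumes "l \<ge> 1"
  shows "1 / (1 - fps_X) ^ l * (\<Sum>k<l. fps_const (of_int (h_vec l G k)) * fps_X ^ k)
    = Abs_fps (\<lambda>d. of_nat (\<Sum>k<l. f_vec G k * (d choose k)) :: rat)"
proof -
  let ?c = "\<lambda>k. Abs_fps (\<lambda>d. of_nat (d choose k)) :: rat fps"
  let ?u = "1 - fps_X :: rat fps"
  have "(\<Sum>k<l. fps_const (of_int (h_vec l G k)) * fps_X ^ k) = fps_of_int_poly (f_sum l G)"
    unfolding f_sum_eq_h_vec[OF assms] by (simp add: fps_of_int_poly_simps of_int_poly)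
  also have "\<dots> = (\<Sum>k<l. fps_const (of_nat (f_vec G k)) * fps_X ^ k * ?u ^ (l - 1 - k))"
    unfolding f_sum_def by (simp add: fps_of_int_poly_simps of_nat_poly mult.assoc)
  also have "\<dots> = (\<Sum>k<l. fps_const (of_nat (f_vec G k)) * ?c k) * ?u ^ l"
    unfolding sum_distrib_right
  proof (rule sum.cong)
    fix k assume "k \<in> {..<l}"
    then have "l = Suc k + (l - 1 - k)" by auto
    then have "?u ^ l = ?u ^ Suc k * ?u ^ (l - 1 - k)" by (metis power_add)
    then show "fps_const (of_nat (f_vec G k)) * fps_X ^ k * ?u ^ (l - 1 - k)
        = fps_const (of_nat (f_vec G k)) * ?c k * ?u ^ l"
      by (simp only: fps_binomial_column[of k, symmetric] mult.assoc)
  qed simp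
  also have "(\<Sum>k<l. fps_const (of_nat (f_vec G k)) * ?c k)
      = Abs_fps (\<lambda>d. of_nat (\<Sum>k<l. f_vec G k * (d choose k)))"
    by (rule fps_ext) (simp add: fps_sum_nth)
  finally have eq: "(\<Sum>k<l. fps_const (of_int (h_vec l G k)) * fps_X ^ k)
      = Abs_fps (\<lambda>d. of_nat (\<Sum>k<l. f_vec G k * (d choose k))) * ?u ^ l" .
  have "fps_nth (?u ^ l) 0 \<noteq> 0" by (simp add: fps_power_zeroth)
  then have "1 / ?u ^ l * ?u ^ l = 1"
    by (simp add: fps_divide_unit inverse_mult_eq_1)
  then show ?thesis
    unfolding eq mult.left_commute[of "1 / ?u ^ l"] by simp
qed

section \<open>Coefficients of a derivation in local coordinates\<close>

text \<open>The coefficient of the monomial \<open>m\<close> in the expansion of \<open>f\<^sub>v\<close> in the coordinates centred at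
  \<open>v\<close>, where \<open>f\<^sub>v\<close> is the coefficient of \<open>\<partial>\<^sub>v\<close> in \<open>\<theta>\<close>.\<close>

definition coef :: "'k::field der \<Rightarrow> nat \<Rightarrow> (nat \<Rightarrow>\<^sub>0 nat) \<Rightarrow> 'k" where
  "coef \<theta> v m = lookup (subst (to_local v) (lookup \<theta> v)) m"

lemma coef_zero: "coef 0 v m = 0"
  by (simp add: coef_def)

lemma coef_add: "coef (\<theta> + \<eta>) v m = coef \<theta> v m + coef \<eta> v m"
  by (simp add: coef_def lookup_add)

lemma lookup_const_mult: "lookup (const c * p) m = c * lookup p m"
  using Poly_Mapping.map.rep_eq[of "(*) c" p]
  by (simp add: const_def when_def flip: mult_map_scale_conv_mult)

lemma coef_scale: "coef (der_scale c \<theta>) v m = c * coef \<theta> v m"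
  by (simp add: coef_def lookup_der_scale lookup_const_mult)

lemma coef_sum: "coef (\<Sum>x\<in>A. f x) v m = (\<Sum>x\<in>A. coef (f x) v m)"
  by (induction A rule: infinite_finite_induct) (simp_all add: coef_zero coef_add)

lemma coef_nonzero_keys:
  assumes "\<theta> \<in> Der l" "coef \<theta> v m \<noteq> 0" "v \<noteq> 0"
  shows "keys m \<subseteq> {0..l} - {v}"
proof -
  have "lookup \<theta> v \<in> polys_in {1..l}"
    using assms(1) by (simp add: Der_def polys_eq_polys_in)
  then have "subst (to_local v) (lookup \<theta> v) \<in> polys_in (insert 0 ({0..l} - {v}))"
    by (rule subst_in_polys_in) (auto simp: to_local_def intro!: polys_in_add polys_in_var)
  moreover have "m \<in> keys (subst (to_local v) (lookup \<theta> v))"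
    using assms(2) by (simp add: coef_def in_keys_iff)
  ultimately have "keys m \<subseteq> insert 0 ({0..l} - {v})" unfolding polys_in_def by blast
  then show ?thesis using assms(3) by auto
qed

lemma coef_nonzero_mdeg:
  assumes "der_homogeneous d \<theta>" "coef \<theta> v m \<noteq> 0"
  shows "mdeg m = d"
  using homogeneous_subst_to_local[of d "lookup \<theta> v" v] assms
  by (auto simp: der_homogeneous_def homogeneous_def coef_def in_keys_iff)

text \<open>For a vertex \<open>v\<close> the coordinate change is injective on \<open>S\<close>, so nothing is lost by passing to the
  coefficients.\<close>

lemma der_eqI_coef:
  assumes "\<theta> \<in> Der l" "\<eta> \<in> Der l"
    and eq: "\<And>v m. v \<in> {1..l} \<Longrightarrow> coef \<theta> v m = coef \<eta> v m"
  shows "\<theta> = \<eta>"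
proof (rule poly_mapping_eqI)
  fix v
  show "lookup \<theta> v = lookup \<eta> v"
  proof (cases "v \<in> {1..l}")
    case True
    then have "subst (to_local v) (lookup \<theta> v) = subst (to_local v) (lookup \<eta> v)"
      using eq unfolding coef_def by (intro poly_mapping_eqI)
    moreover have "lookup \<theta> v \<in> polys l" "lookup \<eta> v \<in> polys l"
      using assms(1,2) by (auto simp: Der_def)
    ultimately show ?thesis by (metis subst_from_to_local)
  next
    case False
    then have "v \<notin> keys \<theta>" "v \<notin> keys \<eta>" using assms(1,2) unfolding Der_def by blast+
    then show ?thesis by (simp add: in_keys_iff)
  qed
qed

text \<open>The edge condition holds if and only if \<open>f\<^sub>u\<close> and \<open>f\<^sub>v\<close> have the same reduction modulo
  \<open>x\<^sub>u - x\<^sub>v\<close>. In the common coordinates these reductions arise by discarding the monomials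
  that involve the index \<open>v\<close> from the expansion of \<open>f\<^sub>u\<close>, which has no index \<open>u\<close> anyway, and vice versa.
  What remains is compared one monomial at a time.\<close>

lemma edge_condition_iff_coef:
  assumes \<theta>: "\<theta> \<in> Der l" and uv: "u \<in> {1..l}" "v \<in> {1..l}" "u \<noteq> v"
  shows "(\<exists>q\<in>polys l. app \<theta> (var u - var v) = (var u - var v) * q)
    \<longleftrightarrow> (\<forall>m. lookup m u = 0 \<longrightarrow> lookup m v = 0 \<longrightarrow> coef \<theta> u m = coef \<theta> v m)"
proof -
  have polys: "lookup \<theta> u \<in> polys l" "lookup \<theta> v \<in> polys l"
    using \<theta> by (auto simp: Der_def)
  have diff: "lookup \<theta> u - lookup \<theta> v \<in> polys l"
    using polys unfolding polys_eq_polys_in by (rule polys_in_diff)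
  have comm: "(to_edge_local u v :: nat \<Rightarrow> 'a mpoly) = to_edge_local v u"
    by (auto simp: to_edge_local_def)
  have u: "subst (to_edge_local u v) (lookup \<theta> u) = subst (kill v) (subst (to_local u) (lookup \<theta> u))"
    using subst_to_edge_local[OF polys(1)] uv by auto
  have v: "subst (to_edge_local u v) (lookup \<theta> v) = subst (kill u) (subst (to_local v) (lookup \<theta> v))"
    using subst_to_edge_local[OF polys(2)] uv unfolding comm by auto
  have zero: "coef \<theta> w m = 0" if "lookup m w \<noteq> 0" "w \<in> {1..l}" for w m
  proof (rule ccontr)
    assume "coef \<theta> w m \<noteq> 0"
    then have "w \<notin> keys m" using coef_nonzero_keys[OF \<theta>, of w m] that(2) by auto
    then show False using that(1) by (simp add: in_keys_iff)
  qed
  have "(\<exists>q\<in>polys l. app \<theta> (var u - var v) = (var u - var v) * q)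
      \<longleftrightarrow> subst (to_edge_local u v) (lookup \<theta> u) = subst (to_edge_local u v) (lookup \<theta> v)"
    unfolding app_var_diff[OF uv(3)] dvd_var_diff_iff[OF diff uv(1,2)] by simp
  also have "\<dots> \<longleftrightarrow> (\<forall>m. (if lookup m v = 0 then coef \<theta> u m else 0) = (if lookup m u = 0 then coef \<theta> v m else 0))"
    unfolding u v poly_mapping_eq_iff fun_eq_iff lookup_subst_kill coef_def ..
  also have "\<dots> \<longleftrightarrow> (\<forall>m. lookup m u = 0 \<longrightarrow> lookup m v = 0 \<longrightarrow> coef \<theta> u m = coef \<theta> v m)"
    using zero[OF _ uv(1)] zero[OF _ uv(2)] by (intro arg_cong[where f = All] ext) auto
  finally show ?thesis .
qed

section \<open>A basis of the part of degree d\<close>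

text \<open>The monomial \<open>m\<close>, read in the coordinates centred at \<open>w\<close>, is placed at every vertex \<open>w\<close> of \<open>W\<close>:
  the derivation \<open>\<Sum>\<^sub>w x\<^sub>w\<^sup>a \<Prod>\<^sub>t (x\<^sub>t - x\<^sub>w)\<^bsup>b(t)\<^esup> \<partial>\<^sub>w\<close>, where \<open>a\<close> and \<open>b(t)\<close> are the exponents of
  \<open>y\<close> and of the index \<open>t\<close> in \<open>m\<close>.\<close>

definition basis_der :: "nat set \<Rightarrow> (nat \<Rightarrow>\<^sub>0 nat) \<Rightarrow> 'k::field der" where
  "basis_der W m = (\<Sum>w\<in>W. single w (subst (from_local w) (single m 1)))"

lemma lookup_basis_der:
  assumes "finite W"
  shows "lookup (basis_der W m) v = (if v \<in> W then subst (from_local v) (single m 1) else 0)"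
  unfolding basis_der_def using assms by (simp add: lookup_sum lookup_single when_def)

lemma coef_basis_der:
  assumes "finite W" "0 \<notin> W" "W \<inter> keys m = {}"
  shows "coef (basis_der W m :: 'k::field der) v n = (if v \<in> W \<and> m = n then 1 else 0)"
proof (cases "v \<in> W")
  case True
  then have "v \<noteq> 0" "lookup m v = 0" using assms by (auto simp: in_keys_iff)
  then have "subst (to_local v) (subst (from_local v) (single m (1 :: 'k))) = single m 1"
    by (simp add: subst_to_from_local subst_kill_single)
  with True show ?thesis
    by (simp add: coef_def lookup_basis_der[OF assms(1)] lookup_single when_def)
qed (simp add: coef_def lookup_basis_der[OF assms(1)])

lemma basis_der_in_Der:
  assumes "W \<subseteq> {1..l}" "keys m \<subseteq> {0..l}"
  shows "(basis_der W m :: 'k::field der) \<in> Der l"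
proof -
  have fin: "finite W" using assms(1) finite_subset by blast
  have "subst (from_local v) (single m (1 :: 'k)) \<in> polys_in {1..l}" if "v \<in> W" for v
  proof (rule subst_in_polys_in)
    show "single m (1 :: 'k) \<in> polys_in {0..l}" using assms(2) by (simp add: polys_in_def)
    fix i assume "i \<in> {0..l}"
    then show "(from_local v i :: 'k mpoly) \<in> polys_in {1..l}"
      using that assms(1) by (auto simp: from_local_def intro!: polys_in_var polys_in_diff)
  qed
  then have "lookup (basis_der W m :: 'k der) v \<in> polys l" for v
    by (simp add: lookup_basis_der[OF fin] polys_eq_polys_in)
  moreover have "keys (basis_der W m :: 'k der) \<subseteq> W"
    by (auto simp: in_keys_iff lookup_basis_der[OF fin] split: if_splits)
  ultimately show ?thesis using assms(1) by (auto simp: Der_def)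
qed

lemma der_homogeneous_basis_der:
  assumes "finite W"
  shows "der_homogeneous (mdeg m) (basis_der W m :: 'k::field der)"
  unfolding der_homogeneous_def lookup_basis_der[OF assms]
  using homogeneous_subst_from_local[of "mdeg m" "single m (1 :: 'k)"]
  by (simp add: homogeneous_def)

lemma Der_add: "\<theta> \<in> Der l \<Longrightarrow> \<eta> \<in> Der l \<Longrightarrow> \<theta> + \<eta> \<in> Der l"
  using keys_add[of \<theta> \<eta>] by (auto simp: Der_def lookup_add polys_eq_polys_in intro: polys_in_add)

lemma Der_scale: "\<theta> \<in> Der l \<Longrightarrow> der_scale c \<theta> \<in> Der l"
  by (auto simp: Der_def lookup_der_scale polys_eq_polys_in in_keys_iff subset_iff intro: polys_in_mult)

lemma subspace_Der: "der.subspace (Der l)"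
  by (rule der.subspaceI) (auto simp: Der_add Der_scale, simp add: Der_def polys_eq_polys_in)

text \<open>For a basis index \<open>((W, T), m)\<close> and a vertex \<open>v\<close> of \<open>W\<close>, the coefficient of \<open>m\<close> at \<open>v\<close> is 1 on the
  basis element with this index and 0 on all others: \<open>m\<close> determines \<open>T\<close>, and \<open>T\<close> and \<open>v\<close> determine
  \<open>W\<close>. This duality gives linear independence. It also gives generation, because a
  logarithmic derivation has the same coefficient of \<open>m\<close> at all vertices of \<open>W\<close>.\<close>

lemma dim_log_der:
  fixes G :: "(nat, 'e) pre_digraph"
  assumes "graph G" and verts: "verts G = {1..l}"
  shows "der.dim {\<theta> \<in> log_der l G :: 'k::field der set. der_homogeneous d \<theta>}
    = (\<Sum>k<l. f_vec G k * (d choose k))"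
proof -
  interpret graph G by fact
  have sym: "sym_digraph G" by (rule sym_digraph_axioms)
  note PG_subset = PG_subset[OF sym, unfolded verts]
  let ?D = "{\<theta> \<in> log_der l G :: 'k der set. der_homogeneous d \<theta>}"
  define I where "I = (SIGMA \<sigma>:PG G. monoms (snd \<sigma>) d)"
  define b :: "(nat set \<times> nat set) \<times> (nat \<Rightarrow>\<^sub>0 nat) \<Rightarrow> 'k der" where "b = (\<lambda>(\<sigma>, m). basis_der (fst \<sigma>) m)"
  \<comment> \<open>A vertex at which the dual functional of a basis element is evaluated; any choice would do.\<close>
  define pivot :: "nat set \<Rightarrow> nat" where "pivot W = (SOME v. v \<in> W)" for W
  have arc: "u \<in> {1..l}" "v \<in> {1..l}" "u \<noteq> v" if "u \<rightarrow>\<^bsub>G\<^esub> v" for u v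
    using that adj_in_verts[OF that] verts adj_not_same by auto

  have finPG: "finite (PG G)"
  proof (rule finite_subset)
    show "PG G \<subseteq> Pow {1..l} \<times> Pow {1..l}" using PG_subset(1,2) by (intro subrelI) blast
  qed simp
  have T: "finite T" "0 \<notin> T" "card T < l" if "(W, T) \<in> PG G" for W T
  proof -
    have "T \<subset> {1..l}" using PG_subset[OF that] by blast
    then show "finite T" "0 \<notin> T" "card T < l"
      using finite_subset psubset_card_mono[of "{1..l}" T] by auto
  qed
  have monoms: "finite (monoms (snd \<sigma>) d)" "card (monoms (snd \<sigma>) d) = d choose rank \<sigma>"
    if "\<sigma> \<in> PG G" for \<sigma>
    using card_monoms[of "snd \<sigma>" d] T[of "fst \<sigma>" "snd \<sigma>"] that by (simp_all add: rank_def)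
  have finI: "finite I" unfolding I_def
    by (rule finite_SigmaI[OF finPG monoms(1)])
  have cardI: "card I = (\<Sum>k<l. f_vec G k * (d choose k))"
  proof -
    have "card I = (\<Sum>\<sigma>\<in>PG G. d choose rank \<sigma>)"
      unfolding I_def using monoms by (simp add: card_SigmaI[OF finPG])
    also have "\<dots> = (\<Sum>k<l. \<Sum>\<sigma>\<in>{\<sigma>\<in>PG G. rank \<sigma> = k}. d choose rank \<sigma>)"
      by (rule sum.group[symmetric]) (use finPG T in \<open>auto simp: rank_def\<close>)
    also have "\<dots> = (\<Sum>k<l. f_vec G k * (d choose k))"
      by (simp add: f_vec_def)
    finally show ?thesis .
  qed

  have I: "W \<subseteq> {1..l}" "finite W" "0 \<notin> W" "pivot W \<in> W" "W \<inter> keys m = {}" "keys m \<subseteq> {0..l}"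
    "mdeg m = d" "T = keys m - {0}" "(W, T) \<in> PG G"
    if "((W, T), m) \<in> I" for W T m
  proof -
    show PG: "(W, T) \<in> PG G" and "mdeg m = d" and T: "T = keys m - {0}"
      using that by (auto simp: I_def monoms_def)
    show W: "W \<subseteq> {1..l}" using PG_subset[OF PG] by blast
    then show "finite W" "0 \<notin> W" using finite_subset by auto
    then show "W \<inter> keys m = {}" using PG_subset[OF PG] T by auto
    show "pivot W \<in> W" unfolding pivot_def using PG_subset(4)[OF PG] by (simp add: some_in_eq)
    show "keys m \<subseteq> {0..l}"
    proof
      fix i assume "i \<in> keys m"
      then show "i \<in> {0..l}" using PG_subset(2)[OF PG] T by (cases "i = 0") auto
    qed
  qed
  have coef_b: "coef (b ((W, T), m)) v n = (if v \<in> W \<and> m = n then 1 else 0)"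
    if "((W, T), m) \<in> I" for W T m v n
    using I[OF that] by (simp add: b_def coef_basis_der)
  have dual: "coef (b y) v m = (if y = ((W, T), m) then 1 else 0)"
    if "y \<in> I" and x: "((W, T), m) \<in> I" and v: "v \<in> W" for y v W T m
  proof (cases "y = ((W, T), m)")
    case True
    then show ?thesis using coef_b[OF x] v by simp
  next
    case False
    obtain W' T' m' where y: "y = ((W', T'), m')" by (metis surj_pair)
    have y': "((W', T'), m') \<in> I" using that(1) unfolding y .
    have "\<not> (v \<in> W' \<and> m' = m)"
    proof
      assume *: "v \<in> W' \<and> m' = m"
      then have "T' = T" using I(8)[OF x] I(8)[OF y'] by simp
      then have "W' = W" using PG_disjoint[OF sym, of W' T W v] I(9)[OF x] I(9)[OF y'] v * by blast
      then show False using False * \<open>T' = T\<close> unfolding y by simp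
    qed
    then show ?thesis using False coef_b[OF y', of v m] unfolding y by (simp only: if_False)
  qed
  have inj: "inj_on b I"
  proof (rule inj_onI)
    fix x y assume "x \<in> I" "y \<in> I" "b x = b y"
    obtain W T m where y: "y = ((W, T), m)" by (metis surj_pair)
    show "x = y"
      using dual[of x W T m "pivot W"] dual[of y W T m "pivot W"] I(4)[of W T m]
        \<open>x \<in> I\<close> \<open>y \<in> I\<close> \<open>b x = b y\<close> unfolding y
      by (metis zero_neq_one)
  qed

  have "b ` I \<subseteq> ?D"
  proof
    fix \<theta> assume "\<theta> \<in> b ` I"
    then obtain W T m where x: "((W, T), m) \<in> I" and \<theta>: "\<theta> = b ((W, T), m)" by auto
    have "\<theta> \<in> Der l" using I[OF x] unfolding \<theta> b_def by (simp add: basis_der_in_Der)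
    moreover have "coef \<theta> u n = coef \<theta> v n"
      if "u \<rightarrow>\<^bsub>G\<^esub> v" "lookup n u = 0" "lookup n v = 0" for u v n
    proof -
      have "v \<rightarrow>\<^bsub>G\<^esub> u" using sym_arcs that(1) by (rule arcs_ends_symmetric)
      then have "u \<in> W \<longleftrightarrow> v \<in> W" if "m = n"
        using PG_closed[OF sym I(9)[OF x], of u v] PG_closed[OF sym I(9)[OF x], of v u]
          \<open>u \<rightarrow>\<^bsub>G\<^esub> v\<close> \<open>lookup n u = 0\<close> \<open>lookup n v = 0\<close> that I(8)[OF x]
        by (auto simp: in_keys_iff)
      then show ?thesis unfolding \<theta> coef_b[OF x] by auto
    qed
    ultimately have "\<theta> \<in> log_der l G"
      using arc edge_condition_iff_coef[OF \<open>\<theta> \<in> Der l\<close>] unfolding log_der_def by blast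
    moreover have "der_homogeneous d \<theta>"
      using I[OF x] der_homogeneous_basis_der[of W m] unfolding \<theta> b_def by simp
    ultimately show "\<theta> \<in> ?D" by simp
  qed
  moreover have "?D \<subseteq> der.span (b ` I)"
  proof
    fix \<theta> assume \<theta>: "\<theta> \<in> ?D"
    then have Der: "\<theta> \<in> Der l" by (simp add: log_der_def)
    define r where "r = (\<lambda>((W, T :: nat set), m). coef \<theta> (pivot W) m)"
    let ?\<eta> = "\<Sum>x\<in>I. der_scale (r x) (b x)"
    have "\<theta> = ?\<eta>"
    proof (rule der_eqI_coef[OF Der])
      show "?\<eta> \<in> Der l"
        using \<open>b ` I \<subseteq> ?D\<close> by (intro der.subspace_sum[OF subspace_Der] Der_scale) (auto simp: log_der_def)
      fix v n assume v: "v \<in> {1..l}"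
      have eta: "coef ?\<eta> v n = (\<Sum>x\<in>I. r x * coef (b x) v n)"
        by (simp add: coef_sum coef_scale)
      show "coef \<theta> v n = coef ?\<eta> v n"
      proof (cases "keys n \<subseteq> {0..l} - {v} \<and> mdeg n = d")
        case True
        let ?T = "keys n - {0}"
        have T: "?T \<subseteq> verts G" "v \<in> verts G - ?T" using True v verts by auto
        then obtain W where W: "(W, ?T) \<in> PG G" "v \<in> W" using PG_cover[OF sym] by blast
        let ?x = "((W, ?T), n)"
        have x: "?x \<in> I" using W(1) True by (simp add: I_def monoms_def)
        have "coef (b y) v n = (if y = ?x then 1 else 0)" if "y \<in> I" for y
          using dual[OF that x W(2)] .
        then have "coef ?\<eta> v n = (\<Sum>y\<in>I. if y = ?x then r y else 0)"
          unfolding eta by (intro sum.cong) auto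
        also have "\<dots> = coef \<theta> (pivot W) n" using finI x by (simp add: r_def)
        also have "\<dots> = coef \<theta> v n"
        proof (rule PG_connected[OF sym W(1) I(4)[OF x] W(2), where c = "\<lambda>u. coef \<theta> u n"])
          fix u w assume uw: "u \<rightarrow>\<^bsub>G\<^esub> w" "u \<notin> ?T" "w \<notin> ?T"
          have "u \<noteq> 0" "w \<noteq> 0" using arc(1,2)[OF uw(1)] by simp_all
          with uw(2,3) have "u \<notin> keys n" "w \<notin> keys n" by blast+
          then have zero: "lookup n u = 0" "lookup n w = 0" by (simp_all add: in_keys_iff)
          have "\<exists>q\<in>polys l. app \<theta> (var u - var w) = (var u - var w) * q"
            using \<theta> uw(1) unfolding log_der_def by blast
          then show "coef \<theta> u n = coef \<theta> w n"
            unfolding edge_condition_iff_coef[OF Der arc[OF uw(1)]] using zero by blast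
        qed
        finally show ?thesis ..
      next
        case False
        then have "coef \<theta> v n = 0"
          using coef_nonzero_keys[OF Der, of v n] coef_nonzero_mdeg[of d \<theta> v n] \<theta> v by auto
        moreover have "coef (b x) v n = 0" if "x \<in> I" for x
        proof -
          obtain W T m where x: "x = ((W, T), m)" by (metis surj_pair)
          show ?thesis
            using False I[of W T m] coef_b[of W T m v n] that unfolding x by auto
        qed
        ultimately show ?thesis unfolding eta by simp
      qed
    qed
    also have "?\<eta> \<in> der.span (b ` I)"
      by (intro der.span_sum der.span_scale der.span_base imageI)
    finally show "\<theta> \<in> der.span (b ` I)" .
  qed
  moreover have "der.independent (b ` I)"
  proof
    assume "der.dependent (b ` I)"
    then obtain u y where y: "y \<in> b ` I" "u y \<noteq> 0" and sum: "(\<Sum>\<theta>\<in>b ` I. der_scale (u \<theta>) \<theta>) = 0"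
      unfolding der.dependent_finite[OF finite_imageI[OF finI]] by blast
    then obtain W T m where x: "((W, T), m) \<in> I" "y = b ((W, T), m)" by auto
    have "0 = coef (\<Sum>z\<in>I. der_scale (u (b z)) (b z)) (pivot W) m"
      using sum by (simp add: sum.reindex[OF inj] coef_zero)
    also have "\<dots> = (\<Sum>z\<in>I. if z = ((W, T), m) then u (b z) else 0)"
      unfolding coef_sum coef_scale by (intro sum.cong) (simp_all add: dual[OF _ x(1) I(4)[OF x(1)]])
    also have "\<dots> = u y" using finI x by simp
    finally show False using y(2) by simp
  qed
  moreover have "card (b ` I) = (\<Sum>k<l. f_vec G k * (d choose k))"
    using card_image[OF inj] cardI by simp
  ultimately show ?thesis by (rule der.dim_unique)
qed

theorem corollary3p1:
  fixes l :: nat and G :: "(nat, 'e) pre_digraph"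
  assumes "l \<ge> 1"
    and "graph G"
    and "verts G = {1..l}"
    and "Digraph_Component.connected G"
  shows "Hilb (log_der l G :: 'k::field der set)
    = 1 / (1 - fps_X) ^ l * (\<Sum>k<l. fps_const (of_int (h_vec l G k)) * fps_X ^ k)"
  unfolding Hilb_def h_vec_generating_function[OF assms(1)] dim_log_der[OF assms(2,3)] ..

end
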